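(* Let $(G,H,\mathcal{L})$ be a cut-and-project scheme and let $W\subseteq H$ be compact. Let $\Lambda\subseteq \curlywedge(W)$ and let $\gamma_\Lambda$ be an autocorrelation of $\Lambda$. Assume that $$I:=\widehat{\gamma_\Lambda}(\{0\})>0 .$$ Then: (a) $\Lambda$ has a Bragg peak at each $\chi\in B_1$, of intensity $\widehat{\gamma_\Lambda}(\{\chi\})\ \geq\ (1-s(\chi))\,I\ >0$. (b) For each $0<\varepsilon<1$ and each $\chi\in B_\varepsilon$, $\Lambda$ has a Bragg peak at $\chi$ of intensity $\widehat{\gamma_\Lambda}(\{\chi\})\ \geq\ (1-\varepsilon)\,I$.
   Context: $G$ is a second countable locally compact Abelian group (LCAG) with Haar measure $|\cdot|$; dual groups are written additively, with $0$ the trivial character. A cut-and-project scheme (CPS) $(G,H,\mathcal{L})$ consists of $G$, an LCAG $H$ and a lattice (discrete co-compact subgroup) $\mathcal{L}\subseteq G\times H$ such that the projection $\pi_G$ is one-to-one on $\mathcal{L}$ and $\pi_H(\mathcal{L})$ is dense in $H$. For $W\subseteq H$, $\curlywedge(W):=\{\pi_G(l): l\in\mathcal{L},\ \pi_H(l)\in W\}$. The annihilator $\mathcal{L}^0=\{(\chi,\psi)\in\widehat G\times\widehat H:\chi(x)\psi(y)=1\ \forall (x,y)\in\mathcal{L}\}$ is a lattice and $(\widehat G,\widehat H,\mathcal{L}^0)$ is a CPS (the dual CPS). Elements of $\mathcal{L}^0$ are written $(\chi,\chi^\star)$. For $V\subseteq\widehat H$, $\curlywedge^\star(V):=\{\chi:(\chi,\chi^\star)\in\mathcal{L}^0,\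 \chi^\star\in V\}$. For $\varepsilon>0$ set $W_\varepsilon:=N(W-W,\varepsilon)=\{\psi\in\widehat H:|\psi(t)-1|<\varepsilon\ \forall t\in W-W\}$ and $B_\varepsilon:=\curlywedge^\star(W_\varepsilon)$. For $(\chi,\chi^\star)\in\mathcal{L}^0$ set $s(\chi):=\sup\{|\chi^\star(t)-1|:t\in W-W\}$. Autocorrelation: a van Hove sequence $(A_n)$ in $G$ is a sequence of compact sets of positive Haar measure with $|\partial^K A_n|/|A_n|\to 0$ for every compact $K\subseteq G$, where $\partial^K A=\overline{(A+K)\setminus A}\cup((\overline{G\setminus A}-K)\cap A)$. An autocorrelation of $\Lambda$ is a vague limit, along some van Hove sequence $(A_n)$ (possibly after passing to a subsequence), of $\frac{1}{|A_n|}\delta_{\Lambda\cap A_n}*\widetilde{\delta_{\Lambda\cap A_n}}$, where $\delta_S=\sum_{x\in S}\delta_x$ and $\widetilde{\mu}(B)=\overline{\mu(-B)}$. It is positive definite and its Fourier transform $\widehat{\gamma_\Lambda}$ (the diffraction measure) is the unique positive measure on $\widehat G$ with $\int_G \varphi*\tilde\varphi\,d\gamma_\Lambda=\int_{\widehat G}|\check\varphi|^2\,d\widehat{\gamma_\Lambda}$ for all $\varphi\in C_c(G)$, where $\tilde\varphi(x)=\overline{\varphi(-x)}$ and $\check\varphi(\chi)=\int_G\chi(x)\varphi(x)\,dx$. $\Lambda$ has a Bragg peak at $\chi$ if $\widehat{\gamma_\Lambda}(\{\chi\})>0$; this number is its intensity. *)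

theory Defs
  imports "HOL-Analysis.Analysis"
begin

section \<open>Locally compact Abelian groups and their duals\<close>

class lcag = topological_ab_group_add + t2_space +
  assumes locally_compact: "\<exists>U K. open U \<and> compact K \<and> x \<in> U \<and> U \<subseteq> K"

lemma locally_compact_space_euclidean: "locally_compact_space (euclidean :: 'a::lcag topology)"
  using locally_compact by (simp add: locally_compact_space_def) blast

typedef (overloaded) ('a::topological_ab_group_add) dual =
  "{\<xi> :: 'a \<Rightarrow> complex. continuous_on UNIV \<xi> \<and> (\<forall>x. norm (\<xi> x) = 1) \<and>
      (\<forall>x y. \<xi> (x + y) = \<xi> x * \<xi> y)}"
  morphisms char_fun Char
  by (rule exI[of _ "\<lambda>_. 1"]) auto

lemma char_fun_continuous: "continuous_on UNIV (char_fun \<xi>)"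
  and norm_char_fun [simp]: "norm (char_fun \<xi> x) = 1"
  and char_fun_add: "char_fun \<xi> (x + y) = char_fun \<xi> x * char_fun \<xi> y"
  using char_fun[of \<xi>] by auto

lemma dual_eqI: "(\<And>x. char_fun \<xi> x = char_fun \<psi> x) \<Longrightarrow> \<xi> = \<psi>"
  by (metis char_fun_inject ext)

instantiation dual :: (topological_ab_group_add) ab_group_add
begin

definition "0 = Char (\<lambda>_. 1)"
definition "\<xi> + \<psi> = Char (\<lambda>x. char_fun \<xi> x * char_fun \<psi> x)"
definition "- \<xi> = Char (\<lambda>x. cnj (char_fun \<xi> x))"
definition "\<xi> - \<psi> = \<xi> + - (\<psi> :: 'a dual)"

lemma char_fun_zero_dual: "char_fun 0 = (\<lambda>_. 1)"
  unfolding zero_dual_def by (rule Char_inverse) auto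

lemma char_fun_plus_dual: "char_fun (\<xi> + \<psi>) = (\<lambda>x. char_fun \<xi> x * char_fun \<psi> x)"
  unfolding plus_dual_def
  by (rule Char_inverse)
     (auto simp: char_fun_add norm_mult intro!: continuous_intros char_fun_continuous)

lemma char_fun_uminus_dual: "char_fun (- \<xi>) = (\<lambda>x. cnj (char_fun \<xi> x))"
  unfolding uminus_dual_def
  by (rule Char_inverse)
     (auto simp: char_fun_add intro!: continuous_intros char_fun_continuous)

instance
proof
  fix \<xi> :: "'a dual"
  have "cnj (char_fun \<xi> x) * char_fun \<xi> x = 1" for x
    by (simp add: complex_norm_square[symmetric] mult.commute)
  then show "- \<xi> + \<xi> = 0"
    by (intro dual_eqI) (simp add: char_fun_zero_dual char_fun_plus_dual char_fun_uminus_dual)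
qed (auto intro!: dual_eqI simp: char_fun_zero_dual char_fun_plus_dual minus_dual_def mult_ac)

end

text \<open>The dual group carries the compact-open topology.\<close>

instantiation dual :: (topological_ab_group_add) topological_space
begin

definition open_dual :: "'a dual set \<Rightarrow> bool" where
  "open_dual = generate_topology
     {{\<xi>. char_fun \<xi> ` K \<subseteq> U} | K U. compact K \<and> open U}"

instance
  by standard (auto simp: open_dual_def intro: generate_topology.intros)

end


section \<open>Cut-and-project schemes\<close>

text \<open>On sets, the operator \<open>-\<close> is set difference, so the Minkowski operations get their own names.\<close>

definition set_sum :: "'a::ab_group_add set \<Rightarrow> 'a set \<Rightarrow> 'a set" where
  "set_sum A B = {a + b | a b. a \<in> A \<and> b \<in> B}"

definition set_diff :: "'a::ab_group_add set \<Rightarrow> 'a set \<Rightarrow> 'a set" where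
  "set_diff A B = {a - b | a b. a \<in> A \<and> b \<in> B}"

definition add_subgroup :: "'a::ab_group_add set \<Rightarrow> bool" where
  "add_subgroup L \<longleftrightarrow> 0 \<in> L \<and> (\<forall>x\<in>L. \<forall>y\<in>L. x + y \<in> L) \<and> (\<forall>x\<in>L. - x \<in> L)"

definition coset :: "'a::ab_group_add set \<Rightarrow> 'a \<Rightarrow> 'a set" where
  "coset L x = {x + l | l. l \<in> L}"

definition quotient_topology :: "'a::{topological_space, ab_group_add} set \<Rightarrow> 'a set topology" where
  "quotient_topology L = topology (\<lambda>U. U \<subseteq> range (coset L) \<and> open (coset L -` U))"

lemma openin_quotient_topology:
  "openin (quotient_topology L) U \<longleftrightarrow> U \<subseteq> range (coset L) \<and> open (coset L -` U)"
proof -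
  have "istopology (\<lambda>U. U \<subseteq> range (coset L) \<and> open (coset L -` U))"
    by (auto simp: istopology_def vimage_Union)
  then show ?thesis
    by (simp add: quotient_topology_def)
qed

definition lattice_in :: "'a::{topological_space, ab_group_add} set \<Rightarrow> bool" where
  "lattice_in L \<longleftrightarrow> add_subgroup L \<and> discrete L \<and> compact_space (quotient_topology L)"

definition cut_and_project :: "('g::lcag \<times> 'h::lcag) set \<Rightarrow> bool" where
  "cut_and_project L \<longleftrightarrow> lattice_in L \<and> inj_on fst L \<and> closure (snd ` L) = UNIV"

definition model_set :: "('a \<times> 'b) set \<Rightarrow> 'b set \<Rightarrow> 'a set" where
  "model_set L W = {fst l | l. l \<in> L \<and> snd l \<in> W}"

definition annihilator ::
    "('g::topological_ab_group_add \<times> 'h::topological_ab_group_add) set \<Rightarrow> ('g dual \<times> 'h dual) set" where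
  "annihilator L = {(\<xi>, \<psi>). \<forall>(x, y)\<in>L. char_fun \<xi> x * char_fun \<psi> y = 1}"

definition star_map ::
    "('g::topological_ab_group_add \<times> 'h::topological_ab_group_add) set \<Rightarrow> 'g dual \<Rightarrow> 'h dual" where
  "star_map L \<xi> = (THE \<psi>. (\<xi>, \<psi>) \<in> annihilator L)"

lemma star_map_eq:
  assumes "cut_and_project L" and \<psi>: "(\<xi>, \<psi>) \<in> annihilator L"
  shows "star_map L \<xi> = \<psi>"
proof -
  have "\<psi>' = \<psi>" if \<psi>': "(\<xi>, \<psi>') \<in> annihilator L" for \<psi>'
  proof (rule dual_eqI)
    fix y
    have "closed {y. char_fun \<psi>' y = char_fun \<psi> y}"
      by (intro closed_Collect_eq char_fun_continuous)
    moreover have "char_fun \<psi>' y = char_fun \<psi> y" if "(x, y) \<in> L" for x y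
    proof -
      have "char_fun \<xi> x * char_fun \<psi>' y = 1" "char_fun \<xi> x * char_fun \<psi> y = 1"
        using \<psi> \<psi>' that by (auto simp: annihilator_def)
      then show ?thesis
        by (metis mult_cancel_left mult_zero_left zero_neq_one)
    qed
    ultimately have "closure (snd ` L) \<subseteq> {y. char_fun \<psi>' y = char_fun \<psi> y}"
      by (intro closure_minimal) auto
    then show "char_fun \<psi>' y = char_fun \<psi> y"
      using assms(1) by (auto simp: cut_and_project_def)
  qed
  with \<psi> show ?thesis
    unfolding star_map_def by (intro the_equality)
qed

text \<open>\<open>W_eps W \<epsilon>\<close> is $N(W - W, \varepsilon)$. The set \<open>B_eps L W \<epsilon>\<close> is the model set with window
  \<open>W_eps W \<epsilon>\<close> in the dual scheme given by \<open>annihilator L\<close>.\<close>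

definition W_eps :: "'h::topological_ab_group_add set \<Rightarrow> real \<Rightarrow> 'h dual set" where
  "W_eps W \<epsilon> = {\<psi>. \<forall>t\<in>set_diff W W. norm (char_fun \<psi> t - 1) < \<epsilon>}"

definition B_eps ::
    "('g::topological_ab_group_add \<times> 'h::topological_ab_group_add) set \<Rightarrow> 'h set \<Rightarrow> real \<Rightarrow> 'g dual set" where
  "B_eps L W \<epsilon> = model_set (annihilator L) (W_eps W \<epsilon>)"

definition s_val ::
    "('g::topological_ab_group_add \<times> 'h::topological_ab_group_add) set \<Rightarrow> 'h set \<Rightarrow> 'g dual \<Rightarrow> real" where
  "s_val L W \<xi> = (SUP t\<in>set_diff W W. norm (char_fun (star_map L \<xi>) t - 1))"


section \<open>Autocorrelation and diffraction\<close>

text \<open>Positive Radon measures. Here this is only used on second countable locally compact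
  Hausdorff groups and on their duals (again second countable, locally compact and Hausdorff),
  where every Borel measure that is finite on compact sets is regular.\<close>

definition radon :: "'a::topological_space measure \<Rightarrow> bool" where
  "radon M \<longleftrightarrow> sets M = sets borel \<and> (\<forall>K. compact K \<longrightarrow> emeasure M K < \<infinity>)"

definition haar_measure :: "'g::{lcag, second_countable_topology} measure \<Rightarrow> bool" where
  "haar_measure M \<longleftrightarrow> radon M \<and>
     (\<forall>x. \<forall>A\<in>sets borel. emeasure M ((+) x ` A) = emeasure M A) \<and>
     (\<forall>U. open U \<and> U \<noteq> {} \<longrightarrow> emeasure M U > 0)"

definition vH_boundary :: "'g::{topological_space, ab_group_add} set \<Rightarrow> 'g set \<Rightarrow> 'g set" where
  "vH_boundary K A = closure (set_sum A K - A) \<union> (set_diff (closure (- A)) K \<inter> A)"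

definition van_Hove :: "'g::{lcag, second_countable_topology} measure \<Rightarrow> (nat \<Rightarrow> 'g set) \<Rightarrow> bool" where
  "van_Hove haar A \<longleftrightarrow> (\<forall>n. compact (A n) \<and> measure haar (A n) > 0) \<and>
     (\<forall>K. compact K \<longrightarrow>
        (\<lambda>n. measure haar (vH_boundary K (A n)) / measure haar (A n)) \<longlonglongrightarrow> 0)"

definition Cc :: "('g::topological_space \<Rightarrow> complex) set" where
  "Cc = {\<phi>. continuous_on UNIV \<phi> \<and> compact (closure {x. \<phi> x \<noteq> 0})}"

definition vague_limit ::
    "(nat \<Rightarrow> 'g::topological_space measure) \<Rightarrow> 'g measure \<Rightarrow> bool" where
  "vague_limit \<mu> \<gamma> \<longleftrightarrow> (\<forall>f\<in>Cc. (\<lambda>n. \<integral>x. f x \<partial>\<mu> n) \<longlonglongrightarrow> (\<integral>x. f x \<partial>\<gamma>))"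

text \<open>The Dirac comb $\delta_S$; its value on a Borel set \<open>B\<close> is the number of points of \<open>S \<inter> B\<close>.\<close>

definition dirac_comb :: "'g::topological_space set \<Rightarrow> 'g measure" where
  "dirac_comb S = distr (count_space S) borel (\<lambda>x. x)"

text \<open>For a positive measure the complex conjugation in $\widetilde\mu(B) = \overline{\mu(-B)}$ has no
  effect, so $\widetilde\mu$ is the image of $\mu$ under $x \mapsto -x$.\<close>

definition reflected :: "'g::{topological_space, ab_group_add} measure \<Rightarrow> 'g measure" where
  "reflected \<mu> = distr \<mu> borel uminus"

definition conv_measure ::
    "'g::{topological_space, ab_group_add} measure \<Rightarrow> 'g measure \<Rightarrow> 'g measure" where
  "conv_measure \<mu> \<nu> = distr (\<mu> \<Otimes>\<^sub>M \<nu>) borel (\<lambda>(x, y). x + y)"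

definition finite_autocorrelation ::
    "'g::{lcag, second_countable_topology} measure \<Rightarrow> 'g set \<Rightarrow> 'g set \<Rightarrow> 'g measure" where
  "finite_autocorrelation haar \<Lambda> A =
     scale_measure (ennreal (1 / measure haar A))
       (conv_measure (dirac_comb (\<Lambda> \<inter> A)) (reflected (dirac_comb (\<Lambda> \<inter> A))))"

definition autocorrelation ::
    "'g::{lcag, second_countable_topology} measure \<Rightarrow> 'g set \<Rightarrow> 'g measure \<Rightarrow> bool" where
  "autocorrelation haar \<Lambda> \<gamma> \<longleftrightarrow> radon \<gamma> \<and>
     (\<exists>A r. van_Hove haar A \<and> strict_mono (r :: nat \<Rightarrow> nat) \<and>
        vague_limit (\<lambda>n. finite_autocorrelation haar \<Lambda> (A (r n))) \<gamma>)"

text \<open>\<open>conv_tilde haar \<phi>\<close> is $\varphi * \widetilde\varphi$ with $\widetilde\varphi(x) = \overline{\varphi(-x)}$.\<close>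

definition tilde :: "('g::ab_group_add \<Rightarrow> complex) \<Rightarrow> 'g \<Rightarrow> complex" where
  "tilde \<phi> x = cnj (\<phi> (- x))"

definition conv_tilde ::
    "'g::{topological_space, ab_group_add} measure \<Rightarrow> ('g \<Rightarrow> complex) \<Rightarrow> 'g \<Rightarrow> complex" where
  "conv_tilde haar \<phi> x = (\<integral>y. \<phi> y * tilde \<phi> (x - y) \<partial>haar)"

definition inv_fourier ::
    "'g::topological_ab_group_add measure \<Rightarrow> ('g \<Rightarrow> complex) \<Rightarrow> 'g dual \<Rightarrow> complex" where
  "inv_fourier haar \<phi> \<xi> = (\<integral>x. char_fun \<xi> x * \<phi> x \<partial>haar)"

text \<open>\<open>\<mu>\<close> is the Fourier transform of \<open>\<gamma>\<close>. Integrability is stated because the library's integral of a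
  non-integrable function is \<open>0\<close>.\<close>

definition fourier_transform_of ::
    "'g::{lcag, second_countable_topology} measure \<Rightarrow> 'g measure \<Rightarrow> 'g dual measure \<Rightarrow> bool" where
  "fourier_transform_of haar \<gamma> \<mu> \<longleftrightarrow> radon \<mu> \<and>
     (\<forall>\<phi>\<in>Cc. integrable \<mu> (\<lambda>\<xi>. (norm (inv_fourier haar \<phi> \<xi>))\<^sup>2) \<and>
        (\<integral>x. conv_tilde haar \<phi> x \<partial>\<gamma>) =
          of_real (\<integral>\<xi>. (norm (inv_fourier haar \<phi> \<xi>))\<^sup>2 \<partial>\<mu>))"

definition bragg_peak :: "'g::topological_ab_group_add dual measure \<Rightarrow> 'g dual \<Rightarrow> bool" where
  "bragg_peak \<mu> \<xi> \<longleftrightarrow> measure \<mu> {\<xi>} > 0"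

end

theory Submission
  imports Defs
begin

text \<open>Let $c_\psi = |\check\psi(0)|^2 > 0$ for some $\psi \ge 0$ in $C_c(G)$ and let
  $\varphi_n = |A_n|^{-1} 1_{A_n} * \psi$. Since averages of a nontrivial character along a
  van Hove sequence vanish in the limit, $|\check\varphi_n|^2$ tends to $c_\psi 1_{\{0\}}$
  pointwise, dominated by $|\check\psi|^2$. Applied to the modulated functions
  $\overline\chi\varphi_n$, the defining identity of $\widehat\gamma$ gives
  $\int \overline\chi F_n \, d\gamma \to c_\psi \widehat\gamma(\{\chi\})$ with
  $F_n = \varphi_n * \widetilde{\varphi_n} \ge 0$. The finite autocorrelations live on
  $\Lambda - \Lambda$, where $|\chi - 1| \le s(\chi)$ because $\chi(x)\chi^\star(x^\star) = 1$; in
  the vague limit $|\int (\overline\chi - 1) F_n \, d\gamma| \le s(\chi) \int F_n \, d\gamma$.\<close>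

section \<open>Functions of compact support\<close>

lemma Cc_I:
  fixes \<phi> :: "'g::t2_space \<Rightarrow> complex"
  assumes "continuous_on UNIV \<phi>" "compact K" "\<And>x. x \<notin> K \<Longrightarrow> \<phi> x = 0"
  shows "\<phi> \<in> Cc"
proof -
  have "closure {x. \<phi> x \<noteq> 0} \<subseteq> K"
    using assms by (intro closure_minimal compact_imp_closed) auto
  then have "K \<inter> closure {x. \<phi> x \<noteq> 0} = closure {x. \<phi> x \<noteq> 0}"
    by blast
  then have "compact (closure {x. \<phi> x \<noteq> 0})"
    using compact_Int_closed[OF assms(2) closed_closure] by metis
  then show ?thesis
    using assms(1) by (simp add: Cc_def)
qed

lemma Cc_E:
  assumes "\<phi> \<in> Cc"
  obtains K where "compact K" "closed K" "\<And>x. x \<notin> K \<Longrightarrow> \<phi> x = 0"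
proof (rule that)
  show "compact (closure {x. \<phi> x \<noteq> 0})"
    using assms unfolding Cc_def by blast
  show "closed (closure {x. \<phi> x \<noteq> 0})"
    by (rule closed_closure)
  show "\<phi> x = 0" if "x \<notin> closure {x. \<phi> x \<noteq> 0}" for x
    using that closure_subset[of "{x. \<phi> x \<noteq> 0}"] by blast
qed

lemma Cc_continuous: "\<phi> \<in> Cc \<Longrightarrow> continuous_on UNIV \<phi>"
  by (simp add: Cc_def)

lemma Cc_bounded:
  assumes "\<phi> \<in> Cc"
  obtains B where "\<And>x. norm (\<phi> x) \<le> B"
proof -
  obtain K where K: "compact K" "\<And>x. x \<notin> K \<Longrightarrow> \<phi> x = 0"
    using Cc_E[OF assms] by metis
  have "bounded (\<phi> ` K)"
    using K(1) Cc_continuous[OF assms]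
    by (intro compact_imp_bounded compact_continuous_image) (auto intro: continuous_on_subset)
  then obtain B where B: "\<And>x. x \<in> K \<Longrightarrow> norm (\<phi> x) \<le> B"
    by (auto simp: bounded_iff)
  have "norm (\<phi> x) \<le> max B 0" for x
    using B[of x] K(2)[of x] by (cases "x \<in> K") auto
  then show thesis
    using that by blast
qed

lemma Cc_integrable:
  assumes "radon M" "\<phi> \<in> Cc"
  shows "integrable M \<phi>"
proof -
  obtain K where K: "compact K" "closed K" "\<And>x. x \<notin> K \<Longrightarrow> \<phi> x = 0"
    using Cc_E[OF assms(2)] by metis
  obtain B where B: "\<And>x. norm (\<phi> x) \<le> B"
    using Cc_bounded[OF assms(2)] by metis
  have M: "sets M = sets borel"
    using assms(1) by (simp add: radon_def)
  show ?thesis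
  proof (rule integrableI_bounded_set[of K])
    show "K \<in> sets M"
      using K M by simp
    show "\<phi> \<in> borel_measurable M"
      using borel_measurable_continuous_onI[OF Cc_continuous[OF assms(2)]]
      by (simp add: measurable_cong_sets[OF M refl])
    show "emeasure M K < \<infinity>"
      using assms(1) K by (simp add: radon_def)
  qed (use B K in auto)
qed

lemma Cc_mult:
  fixes \<phi> :: "'g::t2_space \<Rightarrow> complex"
  assumes "continuous_on UNIV f" "\<phi> \<in> Cc"
  shows "(\<lambda>x. f x * \<phi> x) \<in> Cc"
proof -
  obtain K where "compact K" "\<And>x. x \<notin> K \<Longrightarrow> \<phi> x = 0"
    using Cc_E[OF assms(2)] by metis
  then show ?thesis
    using assms Cc_continuous[OF assms(2)] by (intro Cc_I[of _ K]) (auto intro!: continuous_intros)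
qed

lemma tilde_Cc:
  fixes \<phi> :: "'g::{topological_ab_group_add, t2_space} \<Rightarrow> complex"
  assumes "\<phi> \<in> Cc"
  shows "tilde \<phi> \<in> Cc"
proof -
  obtain K where K: "compact K" "\<And>x. x \<notin> K \<Longrightarrow> \<phi> x = 0"
    using Cc_E[OF assms] by metis
  show ?thesis
  proof (rule Cc_I)
    show "continuous_on UNIV (tilde \<phi>)"
      unfolding tilde_def
      by (intro continuous_intros continuous_on_compose2[OF Cc_continuous[OF assms]]) auto
    show "compact (uminus ` K)"
      using K by (intro compact_continuous_image continuous_intros)
    show "tilde \<phi> x = 0" if "x \<notin> uminus ` K" for x
      using that K(2)[of "- x"] by (force simp: tilde_def image_iff)
  qed
qed

text \<open>A locally compact Hausdorff space is completely regular, so 0 can be separated from the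
  complement of a neighbourhood that lies in a compact set. The bump provides the fixed nonnegative
  factor of all later test functions.\<close>

lemma ex_Cc_bump:
  obtains f :: "'g::lcag \<Rightarrow> real"
  where "(\<lambda>x. complex_of_real (f x)) \<in> Cc" "\<And>x. 0 \<le> f x" "f 0 = 1"
proof -
  obtain U K where U: "open U" "compact K" "(0::'g) \<in> U" "U \<subseteq> K"
    using locally_compact by blast
  have "Hausdorff_space (euclidean :: 'g topology)"
    unfolding Hausdorff_space_def disjnt_def using hausdorff by (simp, meson)
  then have "completely_regular_space (euclidean :: 'g topology)"
    by (intro locally_compact_regular_imp_completely_regular_space
        locally_compact_space_euclidean disjI1)
  moreover have "closedin euclidean (- U)" "0 \<in> topspace euclidean - (- U)"
    using U by (auto simp: closed_Compl)
  ultimately obtain f :: "'g \<Rightarrow> real" where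
    f: "continuous_map euclidean (top_of_set {0..1}) f" "f 0 = 0" "f ` (- U) \<subseteq> {1}"
    unfolding completely_regular_space_def by metis
  have "continuous_on UNIV f" and f01: "\<And>x. f x \<in> {0..1}"
    using f(1) by (auto simp: continuous_map_in_subtopology)
  \<comment> \<open>Complete regularity gives the value 0 at the point and 1 on the closed set; the
    bump needs the reverse, hence \<open>1 - f\<close>.\<close>
  then have "(\<lambda>x. complex_of_real (1 - f x)) \<in> Cc"
    using U f(3) by (intro Cc_I[of _ K]) (auto intro!: continuous_intros)
  then show thesis
    using that[of "\<lambda>x. 1 - f x"] f01 f(2) by auto
qed

section \<open>Haar measure and convolution\<close>

text \<open>Relatively compact open sets have finite measure and cover the group; by second
  countability (Lindelof) countably many of them suffice. This is what makes Fubini available for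
  Haar measure.\<close>

lemma radon_sigma_finite:
  fixes M :: "'g::{lcag, second_countable_topology} measure"
  assumes "radon M"
  shows "sigma_finite_measure M"
proof -
  define F where "F = {U :: 'g set. open U \<and> (\<exists>K. compact K \<and> U \<subseteq> K)}"
  have F_open: "open U" if "U \<in> F" for U
    using that by (simp add: F_def)
  have "\<Union>F = UNIV"
    using locally_compact unfolding F_def by blast
  moreover obtain F' where F': "F' \<subseteq> F" "countable F'" "\<Union>F' = \<Union>F"
    by (rule Lindelof[of F]) (auto simp: F_def)
  moreover have M: "sets M = sets borel"
    using assms by (simp add: radon_def)
  moreover have "emeasure M U \<noteq> \<infinity>" if "U \<in> F" for U
  proof -
    have "\<exists>K. compact K \<and> U \<subseteq> K"
      using that by (simp add: F_def)
    then obtain K where K: "compact K" "U \<subseteq> K"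
      by (elim exE conjE)
    then have "emeasure M U \<le> emeasure M K"
      by (intro emeasure_mono) (auto simp: M borel_compact)
    also have "\<dots> < \<infinity>"
      using K assms by (simp add: radon_def)
    finally show ?thesis
      by simp
  qed
  ultimately show ?thesis
    using sets_eq_imp_space_eq[OF M]
    using F_open by (intro sigma_finite_measure.intro exI[of _ F']) auto
qed

text \<open>The two factors are kept separate because the first will be a normalised indicator
  function, which is integrable but not continuous.\<close>

definition convolution ::
    "'g::{topological_space, ab_group_add} measure \<Rightarrow> ('g \<Rightarrow> complex) \<Rightarrow> ('g \<Rightarrow> complex) \<Rightarrow> 'g \<Rightarrow> complex"
  where "convolution M g k x = (\<integral>y. g y * k (x - y) \<partial>M)"

lemma conv_tilde_eq_convolution: "conv_tilde M \<phi> = convolution M \<phi> (tilde \<phi>)"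
  by (simp add: fun_eq_iff conv_tilde_def convolution_def)

text \<open>Second countability makes the Borel sets of the product coincide with the product
  sigma-algebra.\<close>

lemma continuous_prod_measurable:
  fixes M N :: "'g::second_countable_topology measure"
  assumes "sets M = sets borel" "sets N = sets borel"
    and f: "continuous_on UNIV (f :: 'g \<times> 'g \<Rightarrow> 'b::topological_space)"
  shows "f \<in> borel_measurable (M \<Otimes>\<^sub>M N)"
proof -
  have "sets (M \<Otimes>\<^sub>M N) = sets (borel :: ('g \<times> 'g) measure)"
    unfolding borel_prod[symmetric] by (rule sets_pair_measure_cong[OF assms(1,2)])
  then have "borel_measurable (M \<Otimes>\<^sub>M N) = (borel_measurable borel :: ('g \<times> 'g \<Rightarrow> 'b) set)"
    by (rule measurable_cong_sets) (rule refl)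
  then show ?thesis
    by (rule ssubst) (rule borel_measurable_continuous_onI[OF f])
qed

section \<open>Translation invariance of Haar measure, and convolutions\<close>

context
  fixes haar :: "'g::{lcag, second_countable_topology} measure"
  assumes haar: "haar_measure haar"
begin

lemma haar_radon: "radon haar"
  using haar by (simp add: haar_measure_def)

lemma haar_sets [simp, measurable_cong]: "sets haar = sets borel"
  using haar_radon by (simp add: radon_def)

lemma haar_space [simp]: "space haar = UNIV"
  using sets_eq_imp_space_eq[OF haar_sets] by simp

lemma emeasure_haar_compact: "compact K \<Longrightarrow> emeasure haar K < \<infinity>"
  using haar_radon by (simp add: radon_def)

lemma continuous_haar_measurable:
  "continuous_on UNIV (f :: 'g \<Rightarrow> 'b::topological_space) \<Longrightarrow> f \<in> borel_measurable haar"
  by (simp add: measurable_cong_sets[OF haar_sets refl] borel_measurable_continuous_onI)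

lemma translate_haar_measurable: "(\<lambda>x. x - y) \<in> measurable haar haar"
  using continuous_haar_measurable[of "\<lambda>x. x - y"]
  by (simp add: measurable_cong_sets[OF refl haar_sets] continuous_intros)

lemma distr_haar_translate: "distr haar haar (\<lambda>x. x - y) = haar"
proof (rule measure_eqI)
  fix A assume "A \<in> sets (distr haar haar (\<lambda>x. x - y))"
  then have A: "A \<in> sets borel"
    by simp
  have "(\<lambda>x. x - y) -` A = (+) y ` A"
    by (force simp: image_iff)
  then show "emeasure (distr haar haar (\<lambda>x. x - y)) A = emeasure haar A"
    using A haar by (subst emeasure_distr[OF translate_haar_measurable]) (auto simp: haar_measure_def)
qed simp

lemma haar_integral_translate:
  fixes f :: "'g \<Rightarrow> 'b::{banach, second_countable_topology}"
  assumes "f \<in> borel_measurable haar"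
  shows "(\<integral>x. f (x - y) \<partial>haar) = (\<integral>x. f x \<partial>haar)"
  using integral_distr[OF translate_haar_measurable assms, of y]
  by (simp add: distr_haar_translate)

lemma haar_integrable_translate:
  fixes f :: "'g \<Rightarrow> 'b::{banach, second_countable_topology}"
  assumes "integrable haar f"
  shows "integrable haar (\<lambda>x. f (x - y))"
  using integrable_distr[OF translate_haar_measurable, of y f] assms
  by (simp add: distr_haar_translate)

text \<open>The set where \<open>f\<close> is positive is open and nonempty, so it has positive Haar
  measure, whereas a vanishing integral would make it a null set.\<close>

lemma integral_Cc_pos:
  assumes f: "(\<lambda>x. complex_of_real (f x)) \<in> Cc" "\<And>x. 0 \<le> f x" "f x0 > 0"
  shows "(\<integral>x. f x \<partial>haar) > 0"
proof -
  have int: "integrable haar f"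
    using Cc_integrable[OF haar_radon f(1)] by (simp add: complex_of_real_integrable_eq)
  have "continuous_on UNIV f"
    using Cc_continuous[OF f(1)] continuous_on_Re by fastforce
  then have "open {x. 0 < f x}"
    by (intro open_Collect_less continuous_intros)
  then have pos: "emeasure haar {x. 0 < f x} > 0"
    using haar f(3) by (auto simp: haar_measure_def)
  have "(\<integral>x. f x \<partial>haar) \<noteq> 0"
  proof
    assume "(\<integral>x. f x \<partial>haar) = 0"
    then have "AE x in haar. f x = 0"
      using integral_nonneg_eq_0_iff_AE[OF int] f(2) by simp
    then have "AE x in haar. x \<notin> {x. 0 < f x}"
      by eventually_elim auto
    then have "emeasure haar {x. 0 < f x} = 0"
      using \<open>open {x. 0 < f x}\<close> by (subst (asm) AE_iff_measurable[OF _ refl]) auto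
    with pos show False
      by simp
  qed
  moreover have "(\<integral>x. f x \<partial>haar) \<ge> 0"
    using f(2) by simp
  ultimately show ?thesis
    by linarith
qed

text \<open>The support lies in the compact sum of \<open>K\<close> and a set carrying
  \<open>k\<close>. Continuity comes from \<open>k\<close> alone, by dominated convergence with a
  multiple of \<open>norm (g y)\<close> as majorant.\<close>

lemma convolution_Cc:
  assumes g: "integrable haar g" "compact K" "\<And>x. x \<notin> K \<Longrightarrow> g x = 0" and k: "k \<in> Cc"
  shows "convolution haar g k \<in> Cc"
proof -
  obtain K' where K': "compact K'" "\<And>x. x \<notin> K' \<Longrightarrow> k x = 0"
    using Cc_E[OF k] by metis
  obtain B where B: "\<And>x. norm (k x) \<le> B"
    using Cc_bounded[OF k] by metis
  have kc: "continuous_on UNIV k"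
    using k by (rule Cc_continuous)
  show ?thesis
  proof (rule Cc_I)
    show "compact ((\<lambda>(x, y). x + y) ` (K \<times> K'))"
      using g(2) K'(1) unfolding case_prod_unfold
      by (intro compact_continuous_image compact_Times continuous_intros)
    show "convolution haar g k x = 0" if "x \<notin> (\<lambda>(x, y). x + y) ` (K \<times> K')" for x
    proof -
      have "g y * k (x - y) = 0" for y
      proof (rule ccontr)
        assume "g y * k (x - y) \<noteq> 0"
        then have "y \<in> K" "x - y \<in> K'"
          using g(3) K'(2) by auto
        then have "(y, x - y) \<in> K \<times> K'" and "x = (\<lambda>(x, y). x + y) (y, x - y)"
          by auto
        with that show False
          by blast
      qed
      then show ?thesis
        unfolding convolution_def by (simp only: integral_zero)
    qed
    \<comment> \<open>Dominated convergence handles sequences only; these suffice because the group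
      is first countable.\<close>
    have "(convolution haar g k \<longlongrightarrow> convolution haar g k x) (at x)" for x
      unfolding tendsto_at_iff_sequentially
    proof (intro allI impI)
      fix X assume X: "X \<longlonglongrightarrow> x"
      have "(\<lambda>n. \<integral>y. g y * k (X n - y) \<partial>haar) \<longlonglongrightarrow> (\<integral>y. g y * k (x - y) \<partial>haar)"
      proof (rule integral_dominated_convergence[where w = "\<lambda>y. norm (g y) * B"])
        have meas: "(\<lambda>y. k (z - y)) \<in> borel_measurable haar" for z
          by (intro continuous_haar_measurable continuous_on_compose2[OF kc] continuous_intros) auto
        show "(\<lambda>y. g y * k (x - y)) \<in> borel_measurable haar"
          "\<And>n. (\<lambda>y. g y * k (X n - y)) \<in> borel_measurable haar"
          using g(1) meas by auto
        show "integrable haar (\<lambda>y. norm (g y) * B)"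
          using g(1) by auto
        have "isCont k z" for z
          using kc by (simp add: continuous_on_eq_continuous_at)
        then have "(\<lambda>n. k (X n - y)) \<longlonglongrightarrow> k (x - y)" for y
          by (rule isCont_tendsto_compose) (intro tendsto_intros X)
        then show "AE y in haar. (\<lambda>n. g y * k (X n - y)) \<longlonglongrightarrow> g y * k (x - y)"
          by (intro AE_I2 tendsto_intros)
        show "\<And>n. AE y in haar. norm (g y * k (X n - y)) \<le> norm (g y) * B"
          by (intro AE_I2) (simp add: norm_mult B mult_left_mono)
      qed
      then show "(convolution haar g k \<circ> X) \<longlonglongrightarrow> convolution haar g k x"
        by (simp add: convolution_def o_def)
    qed
    then show "continuous_on UNIV (convolution haar g k)"
      by (simp add: continuous_on_def)
  qed
qed

text \<open>The character splits as \<xi>(x) = \<xi>(y) \<xi>(x - y); after exchanging the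
  integrals, translation invariance turns the inner one into the transform of
  \<open>k\<close>.\<close>

lemma inv_fourier_convolution:
  assumes g: "integrable haar g" and k: "k \<in> Cc"
  shows "inv_fourier haar (convolution haar g k) \<xi> = inv_fourier haar g \<xi> * inv_fourier haar k \<xi>"
proof -
  interpret sigma_finite_measure haar
    by (rule radon_sigma_finite[OF haar_radon])
  interpret pair_sigma_finite haar haar ..
  have kc: "continuous_on UNIV k"
    using k by (rule Cc_continuous)
  have k_int: "integrable haar k"
    using Cc_integrable[OF haar_radon k] .
  define f where "f y x = char_fun \<xi> x * (g y * k (x - y))" for x y
  have "(\<lambda>p. k (snd p - fst p)) \<in> borel_measurable (haar \<Otimes>\<^sub>M haar)"
    by (intro continuous_prod_measurable haar_sets continuous_on_compose2[OF kc] continuous_intros) auto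
  moreover have [measurable]: "char_fun \<xi> \<in> borel_measurable haar"
    by (intro continuous_haar_measurable char_fun_continuous)
  ultimately have "(\<lambda>p. char_fun \<xi> (snd p) * (g (fst p) * k (snd p - fst p)))
      \<in> borel_measurable (haar \<Otimes>\<^sub>M haar)"
    using g by measurable
  then have f_meas: "case_prod f \<in> borel_measurable (haar \<Otimes>\<^sub>M haar)"
    by (simp add: f_def case_prod_unfold)
  have f_int: "integrable haar (f y)" for y
  proof -
    have "integrable haar (\<lambda>x. g y * k (x - y))"
      using haar_integrable_translate[OF k_int] by simp
    moreover then have "(\<lambda>x. char_fun \<xi> x * (g y * k (x - y))) \<in> borel_measurable haar"
      by measurable
    ultimately show ?thesis
      unfolding f_def by (rule Bochner_Integration.integrable_bound) (simp add: norm_mult)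
  qed
  \<comment> \<open>The inner L1 norm is a constant times \<open>norm (g y)\<close>, hence
    integrable in y, as Fubini requires.\<close>
  have "(\<integral>x. norm (f y x) \<partial>haar) = norm (g y) * (\<integral>x. norm (k x) \<partial>haar)" for y
    using haar_integral_translate[of "\<lambda>x. norm (k x)" y] k_int
    by (simp add: f_def norm_mult)
  then have "integrable (haar \<Otimes>\<^sub>M haar) (case_prod f)"
    using f_meas f_int g by (intro Fubini_integrable) auto
  then have "(\<integral>x. (\<integral>y. f y x \<partial>haar) \<partial>haar) = (\<integral>y. (\<integral>x. f y x \<partial>haar) \<partial>haar)"
    by (rule Fubini_integral)
  moreover have "(\<integral>x. f y x \<partial>haar) = char_fun \<xi> y * g y * inv_fourier haar k \<xi>" for y
  proof -
    have "f y x = char_fun \<xi> y * g y * (char_fun \<xi> (x - y) * k (x - y))" for x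
      using char_fun_add[of \<xi> y "x - y"] by (simp add: f_def)
    then have "(\<integral>x. f y x \<partial>haar) = char_fun \<xi> y * g y * (\<integral>x. char_fun \<xi> (x - y) * k (x - y) \<partial>haar)"
      by simp
    also have "(\<integral>x. char_fun \<xi> (x - y) * k (x - y) \<partial>haar) = inv_fourier haar k \<xi>"
      unfolding inv_fourier_def using k_int
      by (intro haar_integral_translate[of "\<lambda>x. char_fun \<xi> x * k x"]) auto
    finally show ?thesis .
  qed
  moreover have "(\<integral>x. (\<integral>y. f y x \<partial>haar) \<partial>haar) = inv_fourier haar (convolution haar g k) \<xi>"
    by (simp add: f_def inv_fourier_def convolution_def)
  ultimately show ?thesis
    by (simp add: inv_fourier_def)
qed

end

section \<open>Characters and modulation\<close>

lemma char_fun_minus: "char_fun \<xi> (- x) = cnj (char_fun \<xi> x)"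
proof -
  have "char_fun \<xi> 0 * char_fun \<xi> 0 = char_fun \<xi> 0"
    using char_fun_add[of \<xi> 0 0] by simp
  moreover have "char_fun \<xi> 0 \<noteq> 0"
    using norm_char_fun[of \<xi> 0] by (metis norm_zero zero_neq_one)
  ultimately have "char_fun \<xi> 0 = 1"
    by simp
  then have "char_fun \<xi> x * char_fun \<xi> (- x) = 1"
    using char_fun_add[of \<xi> x "- x"] by simp
  moreover have "char_fun \<xi> x * cnj (char_fun \<xi> x) = 1"
    by (simp add: complex_norm_square[symmetric])
  ultimately show ?thesis
    by (metis mult_cancel_left mult_zero_left zero_neq_one)
qed

text \<open>Modulation of a test function becomes translation on the dual group. It moves test
  functions whose transforms concentrate at 0 so that they concentrate at \<eta>.\<close>

lemma inv_fourier_modulate: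
  "inv_fourier haar (\<lambda>x. cnj (char_fun \<eta> x) * \<phi> x) \<xi> = inv_fourier haar \<phi> (\<xi> - \<eta>)"
  unfolding inv_fourier_def minus_dual_def char_fun_plus_dual char_fun_uminus_dual
  by (simp only: mult.assoc)

text \<open>The phases contributed by the two factors, at y and at y - x, combine to one that
  depends on x only and so leaves the integral.\<close>

lemma conv_tilde_modulate:
  "conv_tilde haar (\<lambda>x. cnj (char_fun \<eta> x) * \<phi> x) x = cnj (char_fun \<eta> x) * conv_tilde haar \<phi> x"
proof -
  have "cnj (char_fun \<eta> x) = cnj (char_fun \<eta> y) * char_fun \<eta> (- (x - y))" for y
    using char_fun_add[of \<eta> y "x - y"] by (simp add: char_fun_minus del: minus_diff_eq)
  then have "cnj (char_fun \<eta> y) * \<phi> y * tilde (\<lambda>x. cnj (char_fun \<eta> x) * \<phi> x) (x - y)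
      = cnj (char_fun \<eta> x) * (\<phi> y * tilde \<phi> (x - y))" for y
    by (simp add: tilde_def mult_ac)
  then show ?thesis
    unfolding conv_tilde_def by (simp only: integral_mult_right_zero)
qed

text \<open>A character other than \<eta> differs from it at some point x, and the subbasic sets of
  the compact-open topology with the compact set {x} detect this. Singletons are therefore Borel
  sets for the diffraction measure.\<close>

lemma closed_singleton_dual: "closed {\<eta> :: 'a::topological_ab_group_add dual}"
proof -
  have "open {\<xi> :: 'a dual. char_fun \<xi> ` {x} \<subseteq> - {char_fun \<eta> x}}" for x
    unfolding open_dual_def
    by (intro generate_topology.Basis) (use compact_sing open_Compl closed_singleton in blast)
  then have "open (\<Union>x. {\<xi> :: 'a dual. char_fun \<xi> ` {x} \<subseteq> - {char_fun \<eta> x}})"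
    by blast
  also have "(\<Union>x. {\<xi> :: 'a dual. char_fun \<xi> ` {x} \<subseteq> - {char_fun \<eta> x}}) = - {\<eta>}"
    by (auto intro: dual_eqI)
  finally show ?thesis
    by (simp add: closed_def)
qed


lemma integrable_char_mult:
  assumes M: "sets M = sets borel" and f: "integrable M f"
  shows "integrable M (\<lambda>x. char_fun \<xi> x * f x)"
proof (rule Bochner_Integration.integrable_bound[OF f])
  have "char_fun \<xi> \<in> borel_measurable M"
    using borel_measurable_continuous_onI[OF char_fun_continuous]
    by (simp add: measurable_cong_sets[OF M refl])
  then show "(\<lambda>x. char_fun \<xi> x * f x) \<in> borel_measurable M"
    using f by (intro borel_measurable_times) auto
qed (simp add: norm_mult)

lemma norm_integral_le_AE:
  fixes f :: "'a \<Rightarrow> 'b::{banach, second_countable_topology}"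
  assumes "integrable M f" "integrable M g" "AE x in M. norm (f x) \<le> g x"
  shows "norm (\<integral>x. f x \<partial>M) \<le> (\<integral>x. g x \<partial>M)"
proof -
  have "norm (\<integral>x. f x \<partial>M) \<le> (\<integral>x. norm (f x) \<partial>M)"
    by (rule integral_norm_bound)
  also have "\<dots> \<le> (\<integral>x. g x \<partial>M)"
    using assms by (intro integral_mono_AE) auto
  finally show ?thesis .
qed

section \<open>Averages along a van Hove sequence\<close>

text \<open>The density of the uniform probability measure on \<open>A\<close> for compact
  \<open>A\<close> of positive Haar measure; its transform at a character is the mean of the
  character over \<open>A\<close>.\<close>

definition mean_density :: "'g measure \<Rightarrow> 'g set \<Rightarrow> 'g \<Rightarrow> real" where
  "mean_density M A x = indicator A x / measure M A"

lemma mean_density_nonneg: "0 \<le> mean_density M A x"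
  by (simp add: mean_density_def)

context
  fixes haar :: "'g::{lcag, second_countable_topology} measure"
  assumes haar: "haar_measure haar"
begin

lemma compact_haar_sets: "compact A \<Longrightarrow> A \<in> sets haar"
  using borel_compact by (simp add: haar_sets[OF haar])

lemma integrable_indicator_compact: "compact A \<Longrightarrow> integrable haar (indicator A :: 'g \<Rightarrow> real)"
  using compact_haar_sets emeasure_haar_compact[OF haar] by (intro integrable_real_indicator)

lemma integrable_mean_density: "compact A \<Longrightarrow> integrable haar (mean_density haar A)"
  unfolding mean_density_def using integrable_indicator_compact by (intro integrable_divide_zero) auto

lemma integral_mean_density:
  assumes "compact A" "measure haar A > 0"
  shows "(\<integral>x. mean_density haar A x \<partial>haar) = 1"
  using assms compact_haar_sets[of A] by (simp add: mean_density_def haar_space[OF haar])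

lemma integrable_char_of_real:
  "integrable haar f \<Longrightarrow> integrable haar (\<lambda>x. char_fun \<xi> x * complex_of_real (f x))"
  by (intro integrable_char_mult haar_sets[OF haar] integrable_of_real)

text \<open>A probability density is integrated against a function of modulus 1. The bound later
  supplies the majorant for dominated convergence.\<close>

lemma norm_inv_fourier_mean_le:
  assumes "compact A" "measure haar A > 0"
  shows "norm (inv_fourier haar (\<lambda>x. of_real (mean_density haar A x)) \<xi>) \<le> 1"
proof -
  have "norm (inv_fourier haar (\<lambda>x. of_real (mean_density haar A x)) \<xi>)
      \<le> (\<integral>x. mean_density haar A x \<partial>haar)"
    unfolding inv_fourier_def
    by (rule norm_integral_le_AE)
      (use assms in \<open>auto simp: norm_mult mean_density_nonneg
        intro: integrable_char_of_real integrable_mean_density\<close>)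
  then show ?thesis
    using integral_mean_density[OF assms] by simp
qed

lemma inv_fourier_mean_zero:
  assumes "compact A" "measure haar A > 0"
  shows "inv_fourier haar (\<lambda>x. of_real (mean_density haar A x)) 0 = 1"
  using integral_mean_density[OF assms] by (simp add: inv_fourier_def char_fun_zero_dual)

text \<open>Both halves of the boundary are compact: one is closed inside the translate of
  \<open>A\<close> by \<open>t\<close>, the other is closed inside \<open>A\<close>. Finiteness
  matters because \<open>measure\<close> returns 0 on sets of infinite measure, so monotonicity has
  to be justified.\<close>

lemma vH_boundary_singleton_fmeasurable:
  assumes "compact A"
  shows "vH_boundary {t} A \<in> fmeasurable haar"
proof -
  have At: "compact ((\<lambda>x. x + t) ` A)"
    using assms by (intro compact_continuous_image continuous_intros)
  have "set_sum A {t} - A \<subseteq> (\<lambda>x. x + t) ` A"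
    by (auto simp: set_sum_def)
  then have sub: "closure (set_sum A {t} - A) \<subseteq> (\<lambda>x. x + t) ` A"
    using At by (intro closure_minimal compact_imp_closed)
  have "set_diff (closure (- A)) {t} = (\<lambda>x. x + t) -` closure (- A)"
    by (force simp: set_diff_def)
  then have "closed (set_diff (closure (- A)) {t})"
    by (simp add: closed_vimage continuous_intros)
  then have "compact (A \<inter> set_diff (closure (- A)) {t})"
    using assms by (intro compact_Int_closed)
  moreover have "compact ((\<lambda>x. x + t) ` A \<inter> closure (set_sum A {t} - A))"
    using At by (intro compact_Int_closed) auto
  then have "compact (closure (set_sum A {t} - A))"
    using sub by (simp add: Int_absorb1)
  ultimately have "compact (vH_boundary {t} A)"
    unfolding vH_boundary_def by (intro compact_Un) (simp_all add: Int_commute)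
  then show ?thesis
    using compact_haar_sets emeasure_haar_compact[OF haar] by (intro fmeasurableI)
qed

text \<open>Translating \<open>A\<close> by \<open>t\<close> multiplies $\int_A \xi$ by $\xi(t)$ but changes it by at most
  the measure of the symmetric difference of \<open>A\<close> and \<open>A + t\<close>.\<close>

lemma inv_fourier_mean_boundary:
  assumes A: "compact A" "measure haar A > 0"
  shows "norm (char_fun \<xi> t - 1) * norm (inv_fourier haar (\<lambda>x. of_real (mean_density haar A x)) \<xi>)
    \<le> 2 * (measure haar (vH_boundary {t} A) / measure haar A)"
proof -
  let ?d = "mean_density haar A"
  define E where "E = (\<lambda>x. x - t) -` A - A"
  have d_int: "integrable haar ?d" "integrable haar (\<lambda>x. ?d (x - t))"
    using integrable_mean_density[OF A(1)] haar_integrable_translate[OF haar] by auto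
  have "(\<lambda>x. char_fun \<xi> t * (char_fun \<xi> x * of_real (?d x))) \<in> borel_measurable haar"
    using integrable_char_of_real[OF d_int(1), of \<xi>]
    by (intro borel_measurable_integrable integrable_mult_right)
  then have shift_meas: "(\<lambda>x. char_fun \<xi> (x + t) * of_real (?d x)) \<in> borel_measurable haar"
    by (simp add: char_fun_add mult_ac)
  have "char_fun \<xi> t * inv_fourier haar (\<lambda>x. of_real (?d x)) \<xi>
      = (\<integral>x. char_fun \<xi> (x + t) * of_real (?d x) \<partial>haar)"
    by (simp add: inv_fourier_def char_fun_add mult_ac flip: integral_mult_right_zero)
  also have "\<dots> = (\<integral>x. char_fun \<xi> x * of_real (?d (x - t)) \<partial>haar)"
    using haar_integral_translate[OF haar shift_meas, of t] by simp
  finally have "(char_fun \<xi> t - 1) * inv_fourier haar (\<lambda>x. of_real (?d x)) \<xi>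
      = (\<integral>x. char_fun \<xi> x * of_real (?d (x - t)) \<partial>haar) - (\<integral>x. char_fun \<xi> x * of_real (?d x) \<partial>haar)"
    by (simp add: algebra_simps inv_fourier_def)
  also have "\<dots> = (\<integral>x. char_fun \<xi> x * of_real (?d (x - t) - ?d x) \<partial>haar)"
    using integrable_char_of_real[OF d_int(1), of \<xi>] integrable_char_of_real[OF d_int(2), of \<xi>]
    by (simp add: algebra_simps)
  finally have eq: "(char_fun \<xi> t - 1) * inv_fourier haar (\<lambda>x. of_real (?d x)) \<xi>
      = (\<integral>x. char_fun \<xi> x * of_real (?d (x - t) - ?d x) \<partial>haar)" .
  have E_sub: "E \<subseteq> vH_boundary {t} A"
  proof
    fix x assume "x \<in> E"
    then have "x = (x - t) + t" "x - t \<in> A" "x \<notin> A"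
      by (auto simp: E_def)
    then have "x \<in> set_sum A {t} - A"
      unfolding set_sum_def by blast
    then show "x \<in> vH_boundary {t} A"
      unfolding vH_boundary_def by (intro UnI1 subsetD[OF closure_subset])
  qed
  have E_sets: "E \<in> sets haar"
    using measurable_sets[OF translate_haar_measurable[OF haar] compact_haar_sets[OF A(1)], of t]
      compact_haar_sets[OF A(1)] by (simp add: E_def haar_space[OF haar])
  then have E_fin: "E \<in> fmeasurable haar"
    using fmeasurableI2[OF vH_boundary_singleton_fmeasurable[OF A(1)] E_sub] by blast
  then have E_int: "integrable haar (indicator E :: 'g \<Rightarrow> real)"
    by (intro integrable_real_indicator) (auto simp: fmeasurable_def)
  \<comment> \<open>An absolute value is twice the positive part minus the number itself. The
    positive part lives on \<open>E\<close>, the translate of \<open>A\<close> by \<open>t\<close>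
    without \<open>A\<close>; the subtracted difference integrates to 0 by invariance. This is the
    source of the factor 2.\<close>
  have abs_eq: "\<bar>?d (x - t) - ?d x\<bar> = 2 * indicator E x / measure haar A - (?d (x - t) - ?d x)" for x
    using A(2) by (auto simp: mean_density_def E_def split: split_indicator)
  have "norm ((char_fun \<xi> t - 1) * inv_fourier haar (\<lambda>x. of_real (?d x)) \<xi>)
      \<le> (\<integral>x. 2 * indicator E x / measure haar A - (?d (x - t) - ?d x) \<partial>haar)"
    unfolding eq
    by (rule norm_integral_le_AE)
      (use d_int E_int abs_eq in \<open>auto simp: norm_mult simp del: of_real_diff
        intro!: integrable_char_of_real\<close>)
  also have "\<dots> = (\<integral>x. 2 * indicator E x / measure haar A \<partial>haar)
      - ((\<integral>x. ?d (x - t) \<partial>haar) - (\<integral>x. ?d x \<partial>haar))"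
    using d_int E_int by simp
  also have "\<dots> = 2 * (measure haar E / measure haar A)"
    using haar_integral_translate[OF haar, of ?d t] d_int E_sets by (simp add: haar_space[OF haar])
  also have "\<dots> \<le> 2 * (measure haar (vH_boundary {t} A) / measure haar A)"
    using measure_mono_fmeasurable[OF E_sub E_sets vH_boundary_singleton_fmeasurable[OF A(1)]]
    by (simp add: divide_right_mono)
  finally show ?thesis
    by (simp add: norm_mult)
qed

text \<open>A nontrivial character has some \<open>t\<close> with \<xi>(t) \<noteq> 1. The boundary
  estimate for the compact set {t} then forces its means to 0, after division by the nonzero
  constant \<xi>(t) - 1.\<close>

lemma inv_fourier_mean_tendsto:
  assumes "van_Hove haar A"
  shows "(\<lambda>n. inv_fourier haar (\<lambda>x. of_real (mean_density haar (A n) x)) \<xi>)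
    \<longlonglongrightarrow> (if \<xi> = 0 then 1 else 0)"
proof (cases "\<xi> = 0")
  case True
  then show ?thesis
    using assms by (simp add: van_Hove_def inv_fourier_mean_zero)
next
  case False
  let ?a = "\<lambda>n. inv_fourier haar (\<lambda>x. of_real (mean_density haar (A n) x)) \<xi>"
  obtain t where t: "char_fun \<xi> t \<noteq> 1"
    using False dual_eqI[of \<xi> 0] by (auto simp: char_fun_zero_dual)
  have "(\<lambda>n. measure haar (vH_boundary {t} (A n)) / measure haar (A n)) \<longlonglongrightarrow> 0"
    using assms by (simp add: van_Hove_def)
  then have lim: "(\<lambda>n. 2 * (measure haar (vH_boundary {t} (A n)) / measure haar (A n))) \<longlonglongrightarrow> 0"
    by (rule tendsto_mult_right_zero)
  have "(\<lambda>n. norm (char_fun \<xi> t - 1) * norm (?a n)) \<longlonglongrightarrow> 0"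
  proof (rule tendsto_sandwich[OF _ _ tendsto_const lim])
    have "compact (A n)" "measure haar (A n) > 0" for n
      using assms by (auto simp: van_Hove_def)
    then show "\<forall>\<^sub>F n in sequentially. norm (char_fun \<xi> t - 1) * norm (?a n)
        \<le> 2 * (measure haar (vH_boundary {t} (A n)) / measure haar (A n))"
      by (intro always_eventually allI inv_fourier_mean_boundary)
  qed simp
  then have "(\<lambda>n. (char_fun \<xi> t - 1) * ?a n) \<longlonglongrightarrow> 0"
    by (simp flip: norm_mult add: tendsto_norm_zero_iff)
  then have "(\<lambda>n. inverse (char_fun \<xi> t - 1) * ((char_fun \<xi> t - 1) * ?a n)) \<longlonglongrightarrow> 0"
    by (rule tendsto_mult_right_zero)
  then have "?a \<longlonglongrightarrow> 0"
    using t by (simp flip: mult.assoc)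
  with False show ?thesis
    by simp
qed

end

section \<open>The autocorrelation\<close>

lemma sets_dirac_comb [simp]: "sets (dirac_comb S) = sets borel"
  by (simp add: dirac_comb_def)

lemma sets_finite_autocorrelation [simp]: "sets (finite_autocorrelation haar \<Lambda> A) = sets borel"
  by (simp add: finite_autocorrelation_def conv_measure_def)

lemma emeasure_dirac_comb_eq_0:
  assumes "V \<in> sets borel" "V \<inter> S = {}"
  shows "emeasure (dirac_comb S) V = 0"
proof -
  have "(\<lambda>x. x) -` V \<inter> space (count_space S) = {}"
    using assms(2) by auto
  then show ?thesis
    unfolding dirac_comb_def using assms(1) by (subst emeasure_distr) auto
qed

lemma emeasure_reflected:
  fixes \<mu> :: "'g::topological_ab_group_add measure"
  assumes "sets \<mu> = sets borel" "V \<in> sets borel"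
  shows "emeasure (reflected \<mu>) V = emeasure \<mu> (uminus -` V)"
proof -
  have "(uminus :: 'g \<Rightarrow> 'g) \<in> borel_measurable borel"
    by (intro borel_measurable_continuous_onI continuous_intros)
  then have "uminus \<in> measurable \<mu> borel"
    by (simp add: measurable_cong_sets[OF assms(1) refl])
  then show ?thesis
    unfolding reflected_def using assms sets_eq_imp_space_eq[OF assms(1)]
    by (subst emeasure_distr) auto
qed

text \<open>By definition the product measure takes the value of the iterated integral or the
  default value 0, so this inequality holds even without sigma-finiteness. It is enough for showing
  that sets are null.\<close>

lemma emeasure_pair_measure_le:
  "emeasure (M \<Otimes>\<^sub>M N) X \<le> (\<integral>\<^sup>+x. \<integral>\<^sup>+y. indicator X (x, y) \<partial>N \<partial>M)"
  unfolding pair_measure_def emeasure_measure_of_conv by auto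

text \<open>The convolution of the comb of S with its reflection should be carried by S - S. This
  form, with an open set that misses all differences, avoids any measurability question about S -
  S.\<close>

lemma emeasure_conv_dirac_comb_eq_0:
  fixes S U :: "'g::{topological_ab_group_add, second_countable_topology} set"
  assumes U: "open U" "\<And>x y. x \<in> S \<Longrightarrow> y \<in> S \<Longrightarrow> x - y \<notin> U"
  shows "emeasure (conv_measure (dirac_comb S) (reflected (dirac_comb S))) U = 0"
proof -
  let ?D = "dirac_comb S"
  let ?N = "reflected ?D"
  let ?X = "{(x, y). x + y \<in> U}"
  \<comment> \<open>These are the first coordinates whose fibre meets the reflected comb. As a union
    of open sets \<open>V\<close> is measurable whatever the size of \<open>S\<close>, and by
    assumption it is disjoint from \<open>S\<close>.\<close>
  define V where "V = (\<Union>s\<in>S. {x. x - s \<in> U})"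
  have "open {x. x - s \<in> U}" for s
    using open_vimage[OF U(1), of "\<lambda>x. x - s"] by (simp add: vimage_def continuous_intros)
  then have V: "open V"
    by (auto simp: V_def)
  have N: "sets ?N = sets borel"
    by (simp add: reflected_def)
  have sp: "space (?D \<Otimes>\<^sub>M ?N) = UNIV"
    by (simp add: space_pair_measure dirac_comb_def reflected_def)
  have "(\<lambda>(x, y). x + y) \<in> borel_measurable (?D \<Otimes>\<^sub>M ?N)"
    unfolding case_prod_unfold
    by (intro continuous_prod_measurable continuous_intros N) simp
  then have "emeasure (conv_measure ?D ?N) U = emeasure (?D \<Otimes>\<^sub>M ?N) ?X"
    unfolding conv_measure_def using U(1)
    by (subst emeasure_distr) (auto simp: sp intro!: arg_cong[where f = "emeasure _"])
  also have "\<dots> \<le> (\<integral>\<^sup>+x. \<integral>\<^sup>+y. indicator ?X (x, y) \<partial>?N \<partial>?D)"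
    by (rule emeasure_pair_measure_le)
  \<comment> \<open>The fibre over a point outside \<open>V\<close> is null. On \<open>V\<close> the
    crude bound \<open>top\<close> does no harm, since \<open>V\<close> itself is null and
    \<open>top * 0 = 0\<close>.\<close>
  also have "\<dots> \<le> (\<integral>\<^sup>+x. top * indicator V x \<partial>?D)"
  proof (rule nn_integral_mono)
    fix x
    show "(\<integral>\<^sup>+y. indicator ?X (x, y) \<partial>?N) \<le> top * indicator V x"
    proof (cases "x \<in> V")
      case False
      have op: "open {y. x + y \<in> U}" "open {z. x - z \<in> U}"
        using open_vimage[OF U(1), of "\<lambda>y. x + y"] open_vimage[OF U(1), of "\<lambda>y. x - y"]
        by (simp_all add: vimage_def continuous_intros)
      have "(\<integral>\<^sup>+y. indicator ?X (x, y) \<partial>?N) = (\<integral>\<^sup>+y. indicator {y. x + y \<in> U} y \<partial>?N)"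
        by (intro nn_integral_cong) (simp split: split_indicator)
      also have "\<dots> = emeasure ?N {y. x + y \<in> U}"
        using op by (simp add: N)
      also have "\<dots> = emeasure ?D {z. x - z \<in> U}"
        using op by (subst emeasure_reflected) (auto simp: vimage_def)
      also have "\<dots> = 0"
        using op False by (intro emeasure_dirac_comb_eq_0) (auto simp: V_def)
      finally show ?thesis
        by simp
    qed (simp add: top_greatest)
  qed
  also have "\<dots> = top * emeasure ?D V"
    using V by (intro nn_integral_cmult_indicator) simp
  also have "emeasure ?D V = 0"
    using V U(2) by (intro emeasure_dirac_comb_eq_0) (auto simp: V_def)
  finally show ?thesis
    by simp
qed

lemma AE_finite_autocorrelation:
  fixes \<Lambda> :: "'g::{lcag, second_countable_topology} set"
  assumes C: "closed C" "\<And>x y. x \<in> \<Lambda> \<Longrightarrow> y \<in> \<Lambda> \<Longrightarrow> x - y \<in> C"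
  shows "AE x in finite_autocorrelation haar \<Lambda> A. x \<in> C"
proof (rule AE_I')
  have "emeasure (conv_measure (dirac_comb (\<Lambda> \<inter> A)) (reflected (dirac_comb (\<Lambda> \<inter> A)))) (- C) = 0"
    using C by (intro emeasure_conv_dirac_comb_eq_0) auto
  then show "- C \<in> null_sets (finite_autocorrelation haar \<Lambda> A)"
    using C(1) by (intro null_setsI) (simp_all add: finite_autocorrelation_def conv_measure_def)
qed auto

section \<open>Modulation by a character close to 1, and passage to the vague limit\<close>

lemma modulation_bound:
  assumes M: "sets M = sets borel" and r: "\<And>x. 0 \<le> r x"
    and AE: "AE x in M. norm (char_fun \<eta> x - 1) \<le> s"
  shows "norm ((\<integral>x. cnj (char_fun \<eta> x) * of_real (r x) \<partial>M) - (\<integral>x. of_real (r x) \<partial>M))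
    \<le> s * Re (\<integral>x. of_real (r x) \<partial>M)"
proof (cases "integrable M r")
  case True
  then have F: "integrable M (\<lambda>x. complex_of_real (r x))"
    by simp
  then have char: "integrable M (\<lambda>x. cnj (char_fun \<eta> x) * of_real (r x))"
    using integrable_char_mult[OF M F, of "- \<eta>"] by (simp add: char_fun_uminus_dual)
  have "norm (cnj z * complex_of_real (r x) - of_real (r x)) \<le> s * r x" if "norm (z - 1) \<le> s" for x z
  proof -
    have "cnj z * complex_of_real (r x) - of_real (r x) = cnj (z - 1) * of_real (r x)"
      by (simp add: algebra_simps)
    then show ?thesis
      using that r[of x] by (simp only: norm_mult complex_mod_cnj norm_of_real) (simp add: mult_right_mono)
  qed
  then have "AE x in M. norm (cnj (char_fun \<eta> x) * complex_of_real (r x) - of_real (r x)) \<le> s * r x"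
    using AE by (auto elim!: eventually_mono)
  then have "norm (\<integral>x. cnj (char_fun \<eta> x) * complex_of_real (r x) - of_real (r x) \<partial>M)
      \<le> (\<integral>x. s * r x \<partial>M)"
    using True char F by (intro norm_integral_le_AE Bochner_Integration.integrable_diff) auto
  then show ?thesis
    using True char F by simp
next
  \<comment> \<open>A factor of modulus 1 does not affect integrability, so both integrals take the
    default value 0 and the claim reads 0 \<le> 0. This covers the finite autocorrelations without a
    proof that they are finite on compact sets.\<close>
  case False
  have "\<not> integrable M (\<lambda>x. cnj (char_fun \<eta> x) * complex_of_real (r x))"
  proof
    assume "integrable M (\<lambda>x. cnj (char_fun \<eta> x) * complex_of_real (r x))"
    then have "integrable M (\<lambda>x. char_fun \<eta> x * (cnj (char_fun \<eta> x) * complex_of_real (r x)))"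
      by (rule integrable_char_mult[OF M])
    moreover have "char_fun \<eta> x * (cnj (char_fun \<eta> x) * z) = z" for x z
      by (simp add: complex_norm_square[symmetric] flip: mult.assoc)
    ultimately show False
      using False by (simp add: complex_of_real_integrable_eq)
  qed
  then show ?thesis
    using False by (simp add: not_integrable_integral_eq complex_of_real_integrable_eq)
qed

text \<open>Each finite autocorrelation satisfies the bound, and both integrands belong to
  \<open>Cc\<close>, so every term converges in the vague limit and the inequality survives.\<close>

lemma autocorrelation_modulation_bound:
  fixes \<Lambda> :: "'g::{lcag, second_countable_topology} set"
  assumes ac: "autocorrelation haar \<Lambda> \<gamma>"
    and r: "(\<lambda>x. complex_of_real (r x)) \<in> Cc" "\<And>x. 0 \<le> r x"
    and s: "\<And>x y. x \<in> \<Lambda> \<Longrightarrow> y \<in> \<Lambda> \<Longrightarrow> norm (char_fun \<eta> (x - y) - 1) \<le> s"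
  shows "norm ((\<integral>x. cnj (char_fun \<eta> x) * of_real (r x) \<partial>\<gamma>) - (\<integral>x. of_real (r x) \<partial>\<gamma>))
    \<le> s * Re (\<integral>x. of_real (r x) \<partial>\<gamma>)"
proof -
  obtain \<mu> where \<mu>: "vague_limit \<mu> \<gamma>" "\<And>n. \<exists>A. \<mu> n = finite_autocorrelation haar \<Lambda> A"
    using ac unfolding autocorrelation_def by metis
  \<comment> \<open>This closed set contains all differences of points of \<Lambda>, so it carries
    every finite autocorrelation.\<close>
  have "closed {x. norm (char_fun \<eta> x - 1) \<le> s}"
    by (intro closed_Collect_le continuous_intros char_fun_continuous)
  then have AE: "AE x in finite_autocorrelation haar \<Lambda> A. x \<in> {x. norm (char_fun \<eta> x - 1) \<le> s}" for A
    using s by (intro AE_finite_autocorrelation) auto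
  have AE_\<mu>: "AE x in \<mu> n. norm (char_fun \<eta> x - 1) \<le> s" for n
  proof -
    obtain B where B: "\<mu> n = finite_autocorrelation haar \<Lambda> B"
      using \<mu>(2)[of n] by (elim exE)
    show ?thesis
      unfolding B using AE[of B] by (simp only: mem_Collect_eq)
  qed
  have bound: "norm ((\<integral>x. cnj (char_fun \<eta> x) * of_real (r x) \<partial>\<mu> n) - (\<integral>x. of_real (r x) \<partial>\<mu> n))
      \<le> s * Re (\<integral>x. of_real (r x) \<partial>\<mu> n)" for n
    using \<mu>(2)[of n] by (intro modulation_bound r AE_\<mu>) auto
  have "(\<lambda>x. cnj (char_fun \<eta> x) * of_real (r x)) \<in> Cc"
    by (intro Cc_mult r continuous_intros char_fun_continuous)
  then have lim: "(\<lambda>n. \<integral>x. cnj (char_fun \<eta> x) * of_real (r x) \<partial>\<mu> n)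
      \<longlonglongrightarrow> (\<integral>x. cnj (char_fun \<eta> x) * of_real (r x) \<partial>\<gamma>)"
    "(\<lambda>n. \<integral>x. of_real (r x) \<partial>\<mu> n) \<longlonglongrightarrow> (\<integral>x. complex_of_real (r x) \<partial>\<gamma>)"
    using \<mu>(1) r(1) unfolding vague_limit_def by blast+
  show ?thesis
    by (rule LIMSEQ_le[OF tendsto_norm[OF tendsto_diff[OF lim]]
          tendsto_mult_left[OF tendsto_Re[OF lim(2)]]]) (use bound in blast)
qed

section \<open>Bragg peaks\<close>

text \<open>The modulated \<open_phi_n> functions are inserted into the defining identity of
  \<open>\<gamma>_hat\<close>.\<close>

lemma bragg_intensity_limit:
  assumes haar: "haar_measure haar"
    and ft: "fourier_transform_of haar \<gamma> \<gamma>_hat"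
    and A: "van_Hove haar A"
    and \<psi>: "\<psi> \<in> Cc"
  defines "\<phi> \<equiv> \<lambda>n. convolution haar (\<lambda>x. of_real (mean_density haar (A n) x)) \<psi>"
  shows "(\<lambda>n. \<integral>x. cnj (char_fun \<eta> x) * conv_tilde haar (\<phi> n) x \<partial>\<gamma>)
    \<longlonglongrightarrow> of_real ((norm (inv_fourier haar \<psi> 0))\<^sup>2 * measure \<gamma>_hat {\<eta>})"
proof -
  let ?a = "\<lambda>n. inv_fourier haar (\<lambda>x. of_real (mean_density haar (A n) x))"
  have A_props: "compact (A n)" "measure haar (A n) > 0" for n
    using A by (auto simp: van_Hove_def)
  have d_int: "integrable haar (\<lambda>x. complex_of_real (mean_density haar (A n) x))" for n
    using integrable_mean_density[OF haar A_props(1)] by simp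
  have \<phi>_Cc: "\<phi> n \<in> Cc" for n
    unfolding \<phi>_def
    by (rule convolution_Cc[OF haar d_int A_props(1)[of n] _ \<psi>]) (simp add: mean_density_def)
  have mod_Cc: "(\<lambda>x. cnj (char_fun \<eta> x) * f x) \<in> Cc" if "f \<in> Cc" for f
    by (intro Cc_mult that continuous_intros char_fun_continuous)
  have factor: "inv_fourier haar (\<phi> n) \<xi> = ?a n \<xi> * inv_fourier haar \<psi> \<xi>" for n \<xi>
    unfolding \<phi>_def by (rule inv_fourier_convolution[OF haar d_int \<psi>])
  have int: "integrable \<gamma>_hat (\<lambda>\<xi>. (norm (inv_fourier haar f (\<xi> - \<eta>)))\<^sup>2)"
    and eq: "(\<integral>x. cnj (char_fun \<eta> x) * conv_tilde haar f x \<partial>\<gamma>)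
      = of_real (\<integral>\<xi>. (norm (inv_fourier haar f (\<xi> - \<eta>)))\<^sup>2 \<partial>\<gamma>_hat)" if "f \<in> Cc" for f
    using ft mod_Cc[OF that] unfolding fourier_transform_of_def
    unfolding inv_fourier_modulate[symmetric] conv_tilde_modulate[symmetric] by blast+
  let ?c = "(norm (inv_fourier haar \<psi> 0))\<^sup>2"
  have sets_hat: "sets \<gamma>_hat = sets borel" and "emeasure \<gamma>_hat {\<eta>} < \<infinity>"
    using ft by (auto simp: fourier_transform_of_def radon_def)
  have sing: "{\<eta>} \<in> sets \<gamma>_hat"
    unfolding sets_hat by (intro borel_closed closed_singleton_dual)
  have "(\<lambda>n. \<integral>\<xi>. (norm (inv_fourier haar (\<phi> n) (\<xi> - \<eta>)))\<^sup>2 \<partial>\<gamma>_hat)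
      \<longlonglongrightarrow> (\<integral>\<xi>. ?c * indicator {\<eta>} \<xi> \<partial>\<gamma>_hat)"
  proof (rule integral_dominated_convergence[where w = "\<lambda>\<xi>. (norm (inv_fourier haar \<psi> (\<xi> - \<eta>)))\<^sup>2"])
    show "(\<lambda>\<xi>. ?c * indicator {\<eta>} \<xi>) \<in> borel_measurable \<gamma>_hat"
      using sing by measurable
    show "(\<lambda>\<xi>. (norm (inv_fourier haar (\<phi> n) (\<xi> - \<eta>)))\<^sup>2) \<in> borel_measurable \<gamma>_hat" for n
      using int[OF \<phi>_Cc] by (rule borel_measurable_integrable)
    show "integrable \<gamma>_hat (\<lambda>\<xi>. (norm (inv_fourier haar \<psi> (\<xi> - \<eta>)))\<^sup>2)"
      using int[OF \<psi>] .
    show "AE \<xi> in \<gamma>_hat. (\<lambda>n. (norm (inv_fourier haar (\<phi> n) (\<xi> - \<eta>)))\<^sup>2)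
        \<longlonglongrightarrow> ?c * indicator {\<eta>} \<xi>"
    proof (rule AE_I2)
      fix \<xi>
      have "(\<lambda>n. (norm (?a n (\<xi> - \<eta>) * inv_fourier haar \<psi> (\<xi> - \<eta>)))\<^sup>2)
          \<longlonglongrightarrow> (norm ((if \<xi> - \<eta> = 0 then 1 else 0) * inv_fourier haar \<psi> (\<xi> - \<eta>)))\<^sup>2"
        by (intro tendsto_intros inv_fourier_mean_tendsto[OF haar A])
      then show "(\<lambda>n. (norm (inv_fourier haar (\<phi> n) (\<xi> - \<eta>)))\<^sup>2)
          \<longlonglongrightarrow> ?c * indicator {\<eta>} \<xi>"
        unfolding factor by (cases "\<xi> = \<eta>") simp_all
    qed
    show "AE \<xi> in \<gamma>_hat. norm ((norm (inv_fourier haar (\<phi> n) (\<xi> - \<eta>)))\<^sup>2)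
        \<le> (norm (inv_fourier haar \<psi> (\<xi> - \<eta>)))\<^sup>2" for n
      using norm_inv_fourier_mean_le[OF haar A_props]
      by (intro AE_I2) (simp add: factor norm_mult power_mono mult_left_le_one_le)
  qed
  also have "(\<integral>\<xi>. ?c * indicator {\<eta>} \<xi> \<partial>\<gamma>_hat) = ?c * measure \<gamma>_hat {\<eta>}"
    using sing sets_eq_imp_space_eq[OF sets_hat] by simp
  finally show ?thesis
    unfolding eq[OF \<phi>_Cc] by (rule tendsto_of_real)
qed

lemma bragg_intensity_ge:
  fixes \<Lambda> :: "'g::{lcag, second_countable_topology} set"
  assumes haar: "haar_measure haar"
    and ac: "autocorrelation haar \<Lambda> \<gamma>"
    and ft: "fourier_transform_of haar \<gamma> \<gamma>_hat"
    and s: "\<And>x y. x \<in> \<Lambda> \<Longrightarrow> y \<in> \<Lambda> \<Longrightarrow> norm (char_fun \<eta> (x - y) - 1) \<le> s"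
  shows "measure \<gamma>_hat {\<eta>} \<ge> (1 - s) * measure \<gamma>_hat {0}"
proof -
  obtain A where A: "van_Hove haar A"
    using ac by (auto simp: autocorrelation_def)
  obtain f :: "'g \<Rightarrow> real" where f: "(\<lambda>x. complex_of_real (f x)) \<in> Cc" "\<And>x. 0 \<le> f x" "f 0 = 1"
    using ex_Cc_bump by metis
  define d where "d = (\<lambda>n. mean_density haar (A n))"
  define p where "p n x = (\<integral>y. d n y * f (x - y) \<partial>haar)" for n x
  define r where "r n x = (\<integral>y. p n y * p n (- (x - y)) \<partial>haar)" for n x
  have p: "convolution haar (\<lambda>x. of_real (d n x)) (\<lambda>x. of_real (f x)) = (\<lambda>x. of_real (p n x))" for n
    by (simp add: convolution_def p_def fun_eq_iff flip: of_real_mult)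
  have r: "conv_tilde haar (\<lambda>x. of_real (p n x)) x = of_real (r n x)" for n x
    by (simp add: conv_tilde_def tilde_def r_def flip: of_real_mult)
  have p_nonneg: "0 \<le> p n x" for n x
    unfolding p_def d_def by (intro integral_nonneg_AE AE_I2 mult_nonneg_nonneg mean_density_nonneg f)
  then have r_nonneg: "0 \<le> r n x" for n x
    unfolding r_def by (intro integral_nonneg_AE AE_I2 mult_nonneg_nonneg) auto
  have A_compact: "compact (A n)" for n
    using A by (simp add: van_Hove_def)
  have p_Cc: "(\<lambda>x. complex_of_real (p n x)) \<in> Cc" for n
    unfolding p[symmetric] d_def
    by (rule convolution_Cc[OF haar integrable_of_real[OF integrable_mean_density[OF haar A_compact]]
          A_compact[of n] _ f(1)]) (simp add: mean_density_def)
  have r_Cc: "(\<lambda>x. complex_of_real (r n x)) \<in> Cc" for n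
  proof -
    obtain K where "compact K" "\<And>x. x \<notin> K \<Longrightarrow> complex_of_real (p n x) = 0"
      using Cc_E[OF p_Cc] by metis
    then show ?thesis
      unfolding r[symmetric] conv_tilde_eq_convolution
      by (intro convolution_Cc[OF haar] Cc_integrable[OF haar_radon[OF haar]] tilde_Cc p_Cc)
  qed
  define c where "c = (norm (inv_fourier haar (\<lambda>x. complex_of_real (f x)) 0))\<^sup>2"
  have "inv_fourier haar (\<lambda>x. complex_of_real (f x)) 0 = of_real (\<integral>x. f x \<partial>haar)"
    by (simp add: inv_fourier_def char_fun_zero_dual)
  then have "c > 0"
    using integral_Cc_pos[OF haar f(1,2), of 0] f(3) by (simp add: c_def)
  have lim: "(\<lambda>n. \<integral>x. cnj (char_fun \<xi> x) * of_real (r n x) \<partial>\<gamma>)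
      \<longlonglongrightarrow> of_real (c * measure \<gamma>_hat {\<xi>})" for \<xi>
    using bragg_intensity_limit[OF haar ft A f(1), of \<xi>] by (simp only: p[unfolded d_def] r c_def)
  have lim0: "(\<lambda>n. \<integral>x. of_real (r n x) \<partial>\<gamma>) \<longlonglongrightarrow> complex_of_real (c * measure \<gamma>_hat {0})"
    using lim[of 0] by (simp add: char_fun_zero_dual)
  have "norm (complex_of_real (c * measure \<gamma>_hat {\<eta>}) - of_real (c * measure \<gamma>_hat {0}))
      \<le> s * Re (of_real (c * measure \<gamma>_hat {0}))"
    by (rule LIMSEQ_le[OF tendsto_norm[OF tendsto_diff[OF lim lim0]]
          tendsto_mult_left[OF tendsto_Re[OF lim0]]])
      (use autocorrelation_modulation_bound[OF ac r_Cc r_nonneg s] in blast)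
  then have "\<bar>c * measure \<gamma>_hat {\<eta>} - c * measure \<gamma>_hat {0}\<bar> \<le> s * (c * measure \<gamma>_hat {0})"
    by (simp only: Re_complex_of_real norm_of_real flip: of_real_diff)
  then have "c * ((1 - s) * measure \<gamma>_hat {0}) \<le> c * measure \<gamma>_hat {\<eta>}"
    by (simp add: algebra_simps)
  then show ?thesis
    using \<open>c > 0\<close> by simp
qed

lemma norm_char_diff_model_set:
  assumes L: "add_subgroup L" and ann: "(\<eta>, \<psi>) \<in> annihilator L"
    and xy: "x \<in> model_set L W" "y \<in> model_set L W"
  obtains t where "t \<in> set_diff W W" "norm (char_fun \<eta> (x - y) - 1) = norm (char_fun \<psi> t - 1)"
proof -
  obtain u v where uv: "(x, u) \<in> L" "u \<in> W" "(y, v) \<in> L" "v \<in> W"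
    using xy by (force simp: model_set_def)
  then have "(x, u) + - (y, v) \<in> L"
    using L unfolding add_subgroup_def by blast
  then have prod: "char_fun \<eta> (x - y) * char_fun \<psi> (u - v) = 1"
    using ann by (auto simp: annihilator_def)
  then have "char_fun \<eta> (x - y) - 1 = char_fun \<eta> (x - y) * (1 - char_fun \<psi> (u - v))"
    by (simp add: algebra_simps)
  then have "norm (char_fun \<eta> (x - y) - 1) = norm (1 - char_fun \<psi> (u - v))"
    by (simp add: norm_mult)
  moreover have "u - v \<in> set_diff W W"
    using uv by (auto simp: set_diff_def)
  ultimately show thesis
    using that by (simp add: norm_minus_commute)
qed

lemma B_eps_E:
  assumes "cut_and_project L" "\<eta> \<in> B_eps L W \<epsilon>"
  shows "(\<eta>, star_map L \<eta>) \<in> annihilator L"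
    and "t \<in> set_diff W W \<Longrightarrow> norm (char_fun (star_map L \<eta>) t - 1) < \<epsilon>"
proof -
  obtain \<psi> where \<psi>: "(\<eta>, \<psi>) \<in> annihilator L" "\<psi> \<in> W_eps W \<epsilon>"
    using assms(2) by (force simp: B_eps_def model_set_def)
  then have "star_map L \<eta> = \<psi>"
    using star_map_eq[OF assms(1)] by blast
  with \<psi> show "(\<eta>, star_map L \<eta>) \<in> annihilator L"
    and "t \<in> set_diff W W \<Longrightarrow> norm (char_fun (star_map L \<eta>) t - 1) < \<epsilon>"
    by (auto simp: W_eps_def)
qed

lemma s_val_attained:
  fixes L :: "('g::topological_ab_group_add \<times> 'h::topological_ab_group_add) set"
  assumes "compact W" "W \<noteq> {}"
  obtains t where "t \<in> set_diff W W" "s_val L W \<eta> = norm (char_fun (star_map L \<eta>) t - 1)"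
    "\<And>u. u \<in> set_diff W W \<Longrightarrow> norm (char_fun (star_map L \<eta>) u - 1) \<le> s_val L W \<eta>"
proof -
  let ?g = "\<lambda>t. norm (char_fun (star_map L \<eta>) t - 1)"
  have "set_diff W W = (\<lambda>p. fst p - snd p) ` (W \<times> W)"
    by (force simp: set_diff_def)
  then have "compact (set_diff W W)"
    using assms(1) by (simp add: compact_continuous_image compact_Times continuous_intros)
  moreover have "set_diff W W \<noteq> {}"
    using assms(2) by (auto simp: set_diff_def)
  moreover have "continuous_on (set_diff W W) ?g"
    by (intro continuous_intros continuous_on_subset[OF char_fun_continuous]) simp
  ultimately obtain t where t: "t \<in> set_diff W W" "\<And>u. u \<in> set_diff W W \<Longrightarrow> ?g u \<le> ?g t"
    by (meson continuous_attains_sup)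
  then have "s_val L W \<eta> = ?g t"
    unfolding s_val_def by (intro cSup_eq_maximum) auto
  with t show thesis
    using that by metis
qed

theorem theorem3p3:
  fixes L :: "('g::{lcag, second_countable_topology} \<times> 'h::lcag) set"
    and haar :: "'g measure"
    and W :: "'h set"
    and \<Lambda> :: "'g set"
    and \<gamma> :: "'g measure"
    and \<gamma>_hat :: "'g dual measure"
    and I :: real
  assumes "haar_measure haar"
    and "cut_and_project L"
    and "compact W"
    and "\<Lambda> \<subseteq> model_set L W"
    and "autocorrelation haar \<Lambda> \<gamma>"
    and "fourier_transform_of haar \<gamma> \<gamma>_hat"
    and "I = measure \<gamma>_hat {0}"
    and "I > 0"
  shows "(\<forall>\<xi>\<in>B_eps L W 1. bragg_peak \<gamma>_hat \<xi> \<and>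
            measure \<gamma>_hat {\<xi>} \<ge> (1 - s_val L W \<xi>) * I \<and> (1 - s_val L W \<xi>) * I > 0)
       \<and> (\<forall>\<epsilon>. 0 < \<epsilon> \<and> \<epsilon> < 1 \<longrightarrow> (\<forall>\<xi>\<in>B_eps L W \<epsilon>.
            bragg_peak \<gamma>_hat \<xi> \<and> measure \<gamma>_hat {\<xi>} \<ge> (1 - \<epsilon>) * I))"
proof -
  have L: "add_subgroup L"
    using assms(2) by (simp add: cut_and_project_def lattice_in_def)
  have key: "measure \<gamma>_hat {\<xi>} \<ge> (1 - s) * I"
    if ann: "(\<xi>, \<psi>) \<in> annihilator L" and le: "\<And>t. t \<in> set_diff W W \<Longrightarrow> norm (char_fun \<psi> t - 1) \<le> s" for \<xi> \<psi> s
  proof -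
    have "norm (char_fun \<xi> (x - y) - 1) \<le> s" if xy: "x \<in> \<Lambda>" "y \<in> \<Lambda>" for x y
    proof -
      have "x \<in> model_set L W" "y \<in> model_set L W"
        using xy assms(4) by auto
      then show ?thesis
        using norm_char_diff_model_set[OF L ann] le by metis
    qed
    then show ?thesis
      using bragg_intensity_ge[OF assms(1,5,6)] assms(7) by blast
  qed
  \<comment> \<open>For empty \<open>W\<close> the bound would even hold with \<open>s = -1\<close>; and \<open>s_val\<close> would be a junk supremum.\<close>
  have "W \<noteq> {}"
  proof
    assume "W = {}"
    then have "I \<ge> 2 * I"
      using key[of 0 0 "- 1"] assms(7)
      by (auto simp: set_diff_def annihilator_def char_fun_zero_dual)
    with assms(8) show False
      by simp
  qed
  show ?thesis
  proof (intro conjI ballI allI impI)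
    fix \<xi> assume \<xi>: "\<xi> \<in> B_eps L W 1"
    obtain t where t: "t \<in> set_diff W W" "s_val L W \<xi> = norm (char_fun (star_map L \<xi>) t - 1)"
      "\<And>u. u \<in> set_diff W W \<Longrightarrow> norm (char_fun (star_map L \<xi>) u - 1) \<le> s_val L W \<xi>"
      using s_val_attained[OF assms(3) \<open>W \<noteq> {}\<close>] by metis
    show ge: "measure \<gamma>_hat {\<xi>} \<ge> (1 - s_val L W \<xi>) * I"
      using key[OF B_eps_E(1)[OF assms(2) \<xi>] t(3)] .
    show pos: "(1 - s_val L W \<xi>) * I > 0"
      using B_eps_E(2)[OF assms(2) \<xi> t(1)] t(2) assms(8) by simp
    from ge pos show "bragg_peak \<gamma>_hat \<xi>"
      by (simp add: bragg_peak_def)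
  next
    fix \<epsilon> \<xi> assume \<epsilon>: "0 < \<epsilon> \<and> \<epsilon> < 1" and \<xi>: "\<xi> \<in> B_eps L W \<epsilon>"
    show ge: "measure \<gamma>_hat {\<xi>} \<ge> (1 - \<epsilon>) * I"
      using key[OF B_eps_E(1)[OF assms(2) \<xi>] less_imp_le[OF B_eps_E(2)[OF assms(2) \<xi>]]] .
    moreover have "(1 - \<epsilon>) * I > 0"
      using \<epsilon> assms(8) by simp
    ultimately show "bragg_peak \<gamma>_hat \<xi>"
      by (simp add: bragg_peak_def)
  qed
qed

end
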